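(* Let $H_n=\det(E_{i+j})_{0\le i,j\le n-1}$ for $n\ge1$ and $H_0=1$. Then for every integer $k\ge0$: $$H_{4k+1}=(-1)^k\frac{(2k)!^2}{2^{4k(2k-1)}}\prod_{j=1}^{2k-1}(2j+1)!^4,\qquad H_{4k+2}=0,$$ $$H_{4k+3}=(-1)^{k+1}\frac{(2k+1)!^2}{2^{4k(2k+1)}}\prod_{j=1}^{2k}(2j+1)!^4,\qquad H_{4k+4}=(-1)^{k+1}\frac{(2k+1)!^2(4k+3)!^2}{2^{2(2k+1)^2}}\prod_{j=1}^{2k}(2j+1)!^4.$$
   Context: The Euler numbers $E_n$ ($n\ge 0$) are defined by $\tan(x)+\sec(x)=\sum_{n\ge0}E_n\frac{x^n}{n!}$. Empty products equal $1$. *)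

theory Defs
  imports
    "HOL-Computational_Algebra.Formal_Power_Series"
    "Jordan_Normal_Form.Determinant"
begin

text \<open>The Euler (zigzag) numbers 1, 1, 1, 2, 5, 16, 61, \<dots>: the generating function
  \<open>tan x + sec x\<close> is read as a formal power series in \<open>x\<close> with real coefficients.\<close>

definition euler_number :: "nat \<Rightarrow> real" where
  "euler_number n = fact n * fps_nth (fps_tan 1 + inverse (fps_cos 1)) n"

lemma euler_number_egf:
  "fps_tan (1::real) + inverse (fps_cos 1) = Abs_fps (\<lambda>n. euler_number n / fact n)"
  by (simp add: fps_eq_iff euler_number_def)

definition hankel_euler :: "nat \<Rightarrow> real" where
  "hankel_euler n = det (mat n n (\<lambda>(i, j). euler_number (i + j)))"

lemma hankel_euler_0: "hankel_euler 0 = 1"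
  by (simp add: hankel_euler_def)

end

theory Submission
  imports Defs
begin

text \<open>
  Let \<open>L\<close> be the linear functional on polynomials with \<open>L x\<^sup>i = E\<^sub>i\<close> and put \<open>f = tan + sec\<close>, so that
  \<open>2 f' = 1 + f\<^sup>2\<close>. The monic polynomials with
  \<open>p\<^sub>n\<^sub>+\<^sub>1 = (x - (n + 1)) p\<^sub>n - n (n + 1) / 2 p\<^sub>n\<^sub>-\<^sub>1\<close> are orthogonal for the shifted functional
  \<open>q \<mapsto> L (x q)\<close>: the exponential generating function of \<open>L (x\<^sup>j\<^sup>+\<^sup>1 p\<^sub>n)\<close> in \<open>j\<close> is
  \<open>(n + 1)! / 2\<^sup>n (f - 1)\<^sup>n f'\<close>, which has order \<open>n\<close>. Row operations given by the \<open>p\<^sub>n\<close> therefore turn the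
  Hankel matrix of \<open>E\<close> into its first column \<open>L p\<^sub>i\<close> followed by an upper triangular block, and
  the determinant of order \<open>m + 1\<close> is \<open>L p\<^sub>m\<close> times an explicit product, up to sign. The recurrence
  makes \<open>L p\<^sub>n / n!\<close> satisfy \<open>b\<^sub>n\<^sub>+\<^sub>2 = - b\<^sub>n\<^sub>+\<^sub>1 - b\<^sub>n / 2\<close>, whence \<open>b\<^sub>n\<^sub>+\<^sub>4 = - b\<^sub>n / 4\<close>; this explains
  the period four and the zeros.
\<close>

section \<open>Moment functionals and Hankel determinants\<close>

definition moment :: "(nat \<Rightarrow> real) \<Rightarrow> real poly \<Rightarrow> real" where
  "moment \<mu> q = (\<Sum>i\<le>degree q. coeff q i * \<mu> i)"

lemma moment_eq_sum:
  assumes "degree q \<le> n"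
  shows "moment \<mu> q = (\<Sum>i\<le>n. coeff q i * \<mu> i)"
  unfolding moment_def using assms
  by (intro sum.mono_neutral_left) (auto simp: coeff_eq_0)

lemma moment_add: "moment \<mu> (p + q) = moment \<mu> p + moment \<mu> q"
proof -
  let ?n = "max (degree p) (degree q)"
  have "degree (p + q) \<le> ?n" by (rule degree_add_le_max)
  then show ?thesis
    by (simp add: moment_eq_sum[of _ ?n] algebra_simps sum.distrib)
qed

lemma moment_smult: "moment \<mu> (smult c q) = c * moment \<mu> q"
  by (simp add: moment_eq_sum[of "smult c q" "degree q"] moment_def sum_distrib_left algebra_simps)

lemma moment_diff: "moment \<mu> (p - q) = moment \<mu> p - moment \<mu> q"
  using moment_add[of \<mu> p "- q"] moment_smult[of \<mu> "- 1" q] by simp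

text \<open>The range \<open>n\<close> stays free beyond the degree so that the right side is an
  entry of an \<open>n\<close> by \<open>n\<close> matrix product with the Hankel matrix.\<close>

lemma moment_monom_mult:
  assumes "degree q < n"
  shows "moment \<mu> (monom 1 j * q) = (\<Sum>l<n. coeff q l * \<mu> (l + j))"
proof -
  have "moment \<mu> (monom 1 j * q) = (\<Sum>i\<le>j + degree q. coeff (monom 1 j * q) i * \<mu> i)"
    by (intro moment_eq_sum) (metis degree_mult_le degree_monom_le add_mono order_trans order_refl)
  also have "\<dots> = (\<Sum>i\<in>{j..j + degree q}. coeff q (i - j) * \<mu> i)"
    by (intro sum.mono_neutral_cong_right) (auto simp: coeff_monom_mult)
  also have "\<dots> = (\<Sum>l\<le>degree q. coeff q l * \<mu> (l + j))"
    by (rule sum.reindex_bij_witness[of _ "\<lambda>l. l + j" "\<lambda>i. i - j"]) auto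
  also have "\<dots> = (\<Sum>l<n. coeff q l * \<mu> (l + j))"
    using assms by (intro sum.mono_neutral_left) (auto simp: coeff_eq_0)
  finally show ?thesis .
qed

text \<open>The coefficient matrix of monic polynomials of degrees 0, 1, 2, ... is lower
  unitriangular, so left multiplication by it preserves the determinant.\<close>

lemma det_hankel_eq_det_moment:
  fixes p :: "nat \<Rightarrow> real poly"
  assumes deg: "\<And>i. degree (p i) = i" and monic: "\<And>i. coeff (p i) i = 1"
  shows "det (mat n n (\<lambda>(i, j). \<mu> (i + j))) = det (mat n n (\<lambda>(i, j). moment \<mu> (monom 1 j * p i)))"
proof -
  let ?A = "mat n n (\<lambda>(i, l). coeff (p i) l)"
  let ?H = "mat n n (\<lambda>(i, j). \<mu> (i + j))"
  have "det ?A = prod_list (diag_mat ?A)"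
    by (rule det_lower_triangular[of n]) (auto simp: coeff_eq_0 deg)
  also have "diag_mat ?A = replicate n 1"
    using deg monic by (auto simp: diag_mat_def list_eq_iff_nth_eq)
  finally have "det ?A = 1" by simp
  moreover have "?A * ?H = mat n n (\<lambda>(i, j). moment \<mu> (monom 1 j * p i))"
    by (intro eq_matI)
      (auto simp: scalar_prod_def moment_monom_mult[of _ n] deg atLeast0LessThan intro!: sum.cong)
  moreover have "det (?A * ?H) = det ?A * det ?H"
    by (rule det_mult[of _ n]) auto
  ultimately show ?thesis by simp
qed

lemma det_hankel_shifted_orthogonal:
  fixes p :: "nat \<Rightarrow> real poly"
  assumes deg: "\<And>i. degree (p i) = i" and monic: "\<And>i. coeff (p i) i = 1"
    and orth: "\<And>i j. j < i \<Longrightarrow> moment \<mu> (monom 1 (Suc j) * p i) = 0"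
  shows "det (mat (Suc m) (Suc m) (\<lambda>(i, j). \<mu> (i + j))) =
    (- 1) ^ m * moment \<mu> (p m) * (\<Prod>i<m. moment \<mu> (monom 1 (Suc i) * p i))"
proof -
  let ?R = "mat (Suc m) (Suc m) (\<lambda>(i, j). moment \<mu> (monom 1 j * p i))"
  let ?U = "mat_delete ?R m 0"
  have U: "?U = mat m m (\<lambda>(i, j). moment \<mu> (monom 1 (Suc j) * p i))"
    by (intro eq_matI) (auto simp: mat_delete_def)
  have "det ?U = prod_list (diag_mat ?U)"
    unfolding U by (rule det_upper_triangular[of _ m]) (auto simp: upper_triangular_def orth)
  also have "\<dots> = (\<Prod>i<m. moment \<mu> (monom 1 (Suc i) * p i))"
    unfolding U
    by (simp add: prod_list_diag_prod atLeast0LessThan)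
  finally have detU: "det ?U = \<dots>" .
  \<comment> \<open>Orthogonality kills the last row except in column 0; the minor left over is
    upper triangular for the same reason.\<close>
  have "det ?R = (\<Sum>j<Suc m. ?R $$ (m, j) * cofactor ?R m j)"
    by (rule laplace_expansion_row) auto
  also have "\<dots> = ?R $$ (m, 0) * cofactor ?R m 0 + (\<Sum>j<m. ?R $$ (m, Suc j) * cofactor ?R m (Suc j))"
    by (rule sum.lessThan_Suc_shift)
  also have "(\<Sum>j<m. ?R $$ (m, Suc j) * cofactor ?R m (Suc j)) = 0"
    by (intro sum.neutral) (auto simp: orth)
  finally have "det ?R = (- 1) ^ m * moment \<mu> (p m) * det ?U"
    by (simp add: cofactor_def)
  then show ?thesis
    by (simp only: det_hankel_eq_det_moment[OF deg monic] detU)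
qed

section \<open>The orthogonal polynomials\<close>

text \<open>These are the monic Meixner-Pollaczek polynomials with parameters lambda = 1 and phi = 3
  pi / 4.\<close>

fun euler_poly :: "nat \<Rightarrow> real poly" where
  "euler_poly 0 = 1"
| "euler_poly (Suc 0) = [:- 1, 1:]"
| "euler_poly (Suc (Suc n)) = [:- (real n + 2), 1:] * euler_poly (Suc n)
     - smult ((real n + 1) * (real n + 2) / 2) (euler_poly n)"

lemma degree_euler_poly_monic:
  "degree (euler_poly n) = n \<and> coeff (euler_poly n) n = 1"
proof (induction n rule: euler_poly.induct)
  case (3 n)
  have "coeff (euler_poly (Suc (Suc n))) (Suc (Suc n)) = 1"
    using 3 by (simp add: coeff_eq_0)
  moreover have "coeff (euler_poly (Suc (Suc n))) i = 0" if "i > Suc (Suc n)" for i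
    using 3 that by (cases i) (simp_all add: coeff_eq_0)
  then have "degree (euler_poly (Suc (Suc n))) \<le> Suc (Suc n)"
    by (intro degree_le) blast
  ultimately show ?case
    by (metis le_antisym le_degree zero_neq_one)
qed auto

section \<open>The differential equation of tan + sec\<close>

definition euler_gf :: "real fps" where
  "euler_gf = fps_tan 1 + inverse (fps_cos 1)"

lemma euler_number_Suc: "euler_number (Suc j) = fact j * fps_nth (fps_deriv euler_gf) j"
  by (simp add: euler_number_def euler_gf_def algebra_simps)

lemma euler_gf_nth_0: "fps_nth euler_gf 0 = 1"
  by (simp add: euler_gf_def fps_tan_def fps_divide_unit)

lemma euler_gf_ode: "2 * fps_deriv euler_gf = 1 + euler_gf\<^sup>2"
proof -
  define s c v :: "real fps" where "s = fps_sin 1" and "c = fps_cos 1" and "v = inverse c"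
  have c0: "fps_nth c 0 \<noteq> 0" by (simp add: c_def)
  have cv: "c * v = 1"
    using inverse_mult_eq_1'[OF c0] by (simp add: v_def)
  have sc: "s\<^sup>2 + c\<^sup>2 = 1"
    using fps_sin_cos_sum_of_squares[of "1::real"] by (simp add: s_def c_def add.commute)
  have f: "euler_gf = s * v + v"
    unfolding euler_gf_def fps_tan_def s_def v_def c_def
    by (subst fps_divide_unit) auto
  have ds: "fps_deriv s = c" and dc: "fps_deriv c = - s"
    by (simp_all add: s_def c_def fps_sin_deriv fps_cos_deriv flip: fps_const_neg)
  have dv: "fps_deriv v = s * v\<^sup>2"
    using fps_inverse_deriv[OF c0] by (simp add: v_def dc)
  have "v\<^sup>2 = (s\<^sup>2 + c\<^sup>2) * v\<^sup>2" by (simp add: sc)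
  also have "\<dots> = s\<^sup>2 * v\<^sup>2 + (c * v)\<^sup>2" by (simp add: algebra_simps power_mult_distrib)
  finally have v2: "v\<^sup>2 = s\<^sup>2 * v\<^sup>2 + 1" by (simp add: cv)
  have "fps_deriv (s * v + v) = 1 + s\<^sup>2 * v\<^sup>2 + s * v\<^sup>2"
    using cv by (simp add: ds dv power2_eq_square algebra_simps)
  \<comment> \<open>The last summand is grouped so that \<open>v2\<close> folds it into the square
    of \<open>v\<close>, which completes the square of \<open>s * v + v\<close>.\<close>
  then have "2 * fps_deriv (s * v + v) = 1 + (s\<^sup>2 * v\<^sup>2 + 2 * s * v\<^sup>2 + (s\<^sup>2 * v\<^sup>2 + 1))"
    by (simp add: algebra_simps)
  then show ?thesis
    unfolding f by (simp only: flip: v2) (simp add: power2_eq_square algebra_simps)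
qed

lemma euler_gf_deriv2: "fps_deriv (fps_deriv euler_gf) = euler_gf * fps_deriv euler_gf"
proof -
  have "fps_deriv (2 * fps_deriv euler_gf) = 2 * (euler_gf * fps_deriv euler_gf)"
    unfolding euler_gf_ode by (simp add: power2_eq_square algebra_simps)
  then show ?thesis by simp
qed

lemma euler_gf_deriv_nth_0: "fps_nth (fps_deriv euler_gf) 0 = 1"
proof -
  have "fps_nth (2 * fps_deriv euler_gf) 0 = fps_nth (1 + euler_gf\<^sup>2) 0"
    by (simp only: euler_gf_ode)
  then show ?thesis
    by (simp add: fps_power_zeroth euler_gf_nth_0 numeral_fps_const)
qed

section \<open>Generating functions of the shifted moments\<close>

definition euler_moment_gf :: "nat \<Rightarrow> real fps" where
  "euler_moment_gf n = fps_const (fact (Suc n) / 2 ^ n) * (euler_gf - 1) ^ n * fps_deriv euler_gf"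

text \<open>This is the recurrence of \<open>euler_poly\<close> with multiplication by x turned into
  differentiation. With g = f - 1 and F = f', one has F = 1 + g + g^2 / 2 and F' = (1 + g) F, so
  (g^(n+1) F)' = ((n+1) g^n + (n+2) g^(n+1) + (n+3)/2 g^(n+2)) F. The two subtracted terms remove
  the first two summands.\<close>

lemma euler_moment_gf_rec:
  "euler_moment_gf (Suc (Suc n)) = fps_deriv (euler_moment_gf (Suc n))
     - fps_const (real n + 2) * euler_moment_gf (Suc n)
     - fps_const ((real n + 1) * (real n + 2) / 2) * euler_moment_gf n"
proof -
  define g F X where "g = euler_gf - 1" and "F = fps_deriv euler_gf" and "X = g ^ n * F"
  \<comment> \<open>The quarter in \<open>A\<close> makes the three leading coefficients
    \<open>4 * A\<close>, \<open>2 * A * (N + 2)\<close> and \<open>A * (N + 2) * (N + 3)\<close>,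
    free of division.\<close>
  define A N D :: "real fps" where "A = fps_const (fact (Suc n) / 2 ^ n / 4)"
    and "N = fps_const (real n)" and "D = fps_const ((real n + 1) * (real n + 2) / 2)"
  have num: "2 = fps_const (2::real)" "1 = fps_const (1::real)" "3 = fps_const (3::real)"
    "4 = fps_const (4::real)"
    by (simp_all add: numeral_fps_const)
  have ode: "2 * F = 1 + (g + 1)\<^sup>2"
    using euler_gf_ode by (simp add: F_def g_def)
  have dg: "fps_deriv g = F" by (simp add: g_def F_def)
  have dF: "fps_deriv F = (1 + g) * F"
    by (simp add: F_def g_def euler_gf_deriv2)
  have D: "2 * D = (N + 1) * (N + 2)"
    unfolding D_def N_def num by (simp add: algebra_simps add_divide_distrib)
  have c0: "euler_moment_gf n = 4 * A * X"
    unfolding euler_moment_gf_def A_def X_def F_def g_def num by simp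
  have c1: "euler_moment_gf (Suc n) = 2 * A * (N + 2) * (g ^ Suc n * F)"
  proof -
    have "fps_const (fact (Suc (Suc n)) / 2 ^ Suc n) = 2 * A * (N + 2)"
      unfolding A_def N_def num fps_const_add fps_const_mult
      by (rule arg_cong[of _ _ fps_const]) (simp add: field_simps)
    then show ?thesis
      unfolding euler_moment_gf_def F_def g_def by (simp only: mult.assoc)
  qed
  have c2: "euler_moment_gf (Suc (Suc n)) = A * (N + 2) * (N + 3) * (g ^ Suc (Suc n) * F)"
  proof -
    have "fps_const (fact (Suc (Suc (Suc n))) / 2 ^ Suc (Suc n)) = A * (N + 2) * (N + 3)"
      unfolding A_def N_def num fps_const_add fps_const_mult
      by (rule arg_cong[of _ _ fps_const]) (simp add: field_simps)
    then show ?thesis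
      unfolding euler_moment_gf_def F_def g_def by (simp only: mult.assoc)
  qed
  have N1: "fps_const (real (Suc n)) = N + 1"
    unfolding N_def num fps_const_add by (simp add: add.commute)
  have "fps_deriv (g ^ Suc n * F) = (N + 1) * X * F + X * g * (1 + g)"
    unfolding fps_deriv_mult fps_deriv_power N1 dg dF X_def
    by (simp add: algebra_simps)
  moreover have "fps_deriv (2 * A * (N + 2)) = 0"
    unfolding A_def N_def num by simp
  ultimately have d1: "fps_deriv (euler_moment_gf (Suc n)) =
      2 * A * (N + 2) * ((N + 1) * X * F + X * g * (1 + g))"
    unfolding c1 by (subst fps_deriv_mult) simp
  have X1: "g ^ Suc n * F = X * g" "g ^ Suc (Suc n) * F = X * g * g"
    by (simp_all add: X_def algebra_simps)
  have N2: "fps_const (real n + 2) = N + 2"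
    unfolding N_def num by simp
  \<comment> \<open>The factors \<open>2 * F\<close> and \<open>2 * D\<close> are isolated so that
    \<open>ode\<close> and \<open>D\<close> can rewrite them.\<close>
  have "2 * A * (N + 2) * ((N + 1) * X * F + X * g * (1 + g))
      - (N + 2) * (2 * A * (N + 2) * (X * g)) - D * (4 * A * X) =
      A * (N + 2) * (N + 1) * X * (2 * F) + 2 * A * (N + 2) * (X * g * (1 + g))
      - (N + 2) * (2 * A * (N + 2) * (X * g)) - 2 * A * X * (2 * D)"
    by (simp add: algebra_simps)
  also have "\<dots> = A * (N + 2) * (N + 3) * (X * g * g)"
    unfolding ode D by (simp add: power2_eq_square algebra_simps)
  finally show ?thesis
    unfolding N2 D_def[symmetric] d1 unfolding c0 c1 c2 X1 ..
qed

lemma euler_moment_gf_below: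
  assumes "j < n"
  shows "fps_nth (euler_moment_gf n) j = 0"
proof -
  have "fps_nth ((euler_gf - 1) ^ n) i = 0" if "i < n" for i
    using startsby_zero_power_prefix[of "euler_gf - 1" n] that by (simp add: euler_gf_nth_0)
  then show ?thesis
    using assms by (simp add: euler_moment_gf_def mult.assoc fps_mult_nth[of "_ ^ n"])
qed

text \<open>Both f - 1 = x + ... and f' = 1 + ... have leading coefficient 1, so only the constant
  prefactor remains.\<close>

lemma euler_moment_gf_diag: "fps_nth (euler_moment_gf n) n = fact (Suc n) / 2 ^ n"
proof -
  define g where "g = euler_gf - 1"
  have g0: "fps_nth g 0 = 0" and g1: "fps_nth g 1 = 1"
    using euler_gf_deriv_nth_0 by (simp_all add: g_def euler_gf_nth_0)
  have low: "fps_nth (g ^ n) i = 0" if "i < n" for i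
    using startsby_zero_power_prefix[of g n] g0 that by simp
  have "fps_nth (g ^ n * fps_deriv euler_gf) n =
      (\<Sum>i\<in>{n}. fps_nth (g ^ n) i * fps_nth (fps_deriv euler_gf) (n - i))"
    unfolding fps_mult_nth by (intro sum.mono_neutral_right) (auto simp: low)
  also have "\<dots> = 1"
    using startsby_zero_power_nth_same[OF g0, of n] g1 euler_gf_deriv_nth_0 by simp
  finally show ?thesis
    by (simp add: euler_moment_gf_def mult.assoc g_def)
qed

lemma moment_euler_poly:
  "moment euler_number (monom 1 (Suc j) * euler_poly n) = fact j * fps_nth (euler_moment_gf n) j"
proof (induction n arbitrary: j rule: euler_poly.induct)
  case 1
  show ?case
    using moment_monom_mult[of 1 1 euler_number "Suc j"]
    by (simp add: euler_moment_gf_def euler_number_Suc)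
next
  case 2
  \<comment> \<open>For x - 1 the generating function is f'' - f', which equals (f - 1) f' by
    \<open>euler_gf_deriv2\<close>.\<close>
  show ?case
    using moment_monom_mult[of "[:- 1, 1:]" 2 euler_number "Suc j"]
    by (simp add: euler_moment_gf_def euler_number_Suc numeral_2_eq_2 left_diff_distrib
        euler_gf_deriv2[symmetric] algebra_simps)
next
  case (3 n)
  \<comment> \<open>The factor x raises \<open>j\<close> by one, hence the induction over arbitrary
    \<open>j\<close>; the factorial absorbs this shift into \<open>fps_deriv\<close>.\<close>
  have "monom 1 (Suc j) * euler_poly (Suc (Suc n)) =
      monom 1 (Suc (Suc j)) * euler_poly (Suc n)
      - smult (real n + 2) (monom 1 (Suc j) * euler_poly (Suc n))
      - smult ((real n + 1) * (real n + 2) / 2) (monom 1 (Suc j) * euler_poly n)"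
    by (simp add: monom_Suc algebra_simps smult_add_left smult_diff_left)
  then have "moment euler_number (monom 1 (Suc j) * euler_poly (Suc (Suc n))) =
      fact (Suc j) * fps_nth (euler_moment_gf (Suc n)) (Suc j)
      - (real n + 2) * (fact j * fps_nth (euler_moment_gf (Suc n)) j)
      - (real n + 1) * (real n + 2) / 2 * (fact j * fps_nth (euler_moment_gf n) j)"
    by (simp only: moment_diff moment_smult 3)
  also have "\<dots> = fact j * fps_nth (euler_moment_gf (Suc (Suc n))) j"
    unfolding euler_moment_gf_rec by (simp add: algebra_simps)
  finally show ?case .
qed

section \<open>The unshifted moments of the polynomials\<close>

lemma moment_euler_poly_rec:
  "moment euler_number (euler_poly (Suc (Suc n))) =
     - (real n + 2) * moment euler_number (euler_poly (Suc n))
     - (real n + 1) * (real n + 2) / 2 * moment euler_number (euler_poly n)"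
proof -
  have "euler_poly (Suc (Suc n)) = monom 1 (Suc 0) * euler_poly (Suc n)
      - smult (real n + 2) (euler_poly (Suc n))
      - smult ((real n + 1) * (real n + 2) / 2) (euler_poly n)"
    by (simp add: monom_Suc algebra_simps smult_add_left smult_diff_left)
  \<comment> \<open>The term with the factor x is a shifted moment at \<open>j = 0\<close> of a
    polynomial of positive index, so it vanishes.\<close>
  then show ?thesis
    by (simp only: moment_diff moment_smult moment_euler_poly)
      (simp add: euler_moment_gf_below algebra_simps)
qed

lemma moment_euler_poly_0: "moment euler_number (euler_poly 0) = 1"
  using euler_gf_nth_0 by (simp add: moment_def euler_number_def euler_gf_def)

lemma moment_euler_poly_1: "moment euler_number (euler_poly (Suc 0)) = 0"
proof -
  have "euler_number (Suc 0) = 1"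
    unfolding euler_number_Suc using euler_gf_deriv_nth_0 by simp
  then show ?thesis
    using moment_euler_poly_0 by (simp add: moment_def)
qed

text \<open>Dividing by n! makes the recurrence constant-coefficient; its characteristic roots (-1 +
  i)/2 and (-1 - i)/2 both have fourth power -1/4.\<close>

definition normalized_moment :: "nat \<Rightarrow> real" where
  "normalized_moment n = moment euler_number (euler_poly n) / fact n"

lemma normalized_moment_rec: "normalized_moment (Suc (Suc n)) = - normalized_moment (Suc n) - normalized_moment n / 2"
proof -
  have "fact (Suc (Suc n)) = (real n + 2) * ((real n + 1) * fact n)"
    "fact (Suc n) = (real n + 1) * (fact n :: real)"
    by (simp_all add: algebra_simps)
  then show ?thesis
    unfolding normalized_moment_def moment_euler_poly_rec
    by (simp add: divide_simps del: fact_Suc) (simp add: algebra_simps)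
qed

lemma normalized_moment_values:
  "normalized_moment (4 * k) = (- 1 / 4) ^ k \<and> normalized_moment (4 * k + 1) = 0 \<and>
   normalized_moment (4 * k + 2) = - ((- 1 / 4) ^ k) / 2 \<and> normalized_moment (4 * k + 3) = (- 1 / 4) ^ k / 2"
proof -
  have step: "normalized_moment (n + 2) = - normalized_moment (n + 1) - normalized_moment n / 2" for n
    using normalized_moment_rec[of n] by simp
  have base: "normalized_moment (4 * k) = (- 1 / 4) ^ k \<and> normalized_moment (4 * k + 1) = 0" for k
  proof (induction k)
    case 0
    show ?case
      using moment_euler_poly_0 moment_euler_poly_1 by (simp add: normalized_moment_def)
  next
    case (Suc k)
    then show ?case
      using step[of "4 * k"] step[of "4 * k + 1"] step[of "4 * k + 2"] step[of "4 * k + 3"]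
      by (simp add: numeral_eq_Suc)
  qed
  then show ?thesis
    using base[of k] step[of "4 * k"] step[of "4 * k + 1"] by (simp add: numeral_eq_Suc)
qed

section \<open>Evaluation of the determinants\<close>

lemma hankel_euler_Suc:
  "hankel_euler (Suc m) = (- 1) ^ m * fact m * normalized_moment m * (\<Prod>i<m. fact i * fact (Suc i) / 2 ^ i)"
proof -
  have "hankel_euler (Suc m) = (- 1) ^ m * moment euler_number (euler_poly m) *
      (\<Prod>i<m. moment euler_number (monom 1 (Suc i) * euler_poly i))"
    unfolding hankel_euler_def
    by (rule det_hankel_shifted_orthogonal)
      (use degree_euler_poly_monic in \<open>auto simp: moment_euler_poly euler_moment_gf_below\<close>)
  then show ?thesis
    by (simp add: moment_euler_poly euler_moment_gf_diag normalized_moment_def)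
qed

text \<open>The factors are taken in pairs i = 2t, 2t + 1, with denominators cleared. The extra
  \<open>fact (2 * t)\<close> on the left absorbs the even factorial of the next pair, and the new
  \<open>fact (2 * Suc t)\<close> supplies the fourth copy of (2t + 1)!.\<close>

lemma prod_norms_even:
  "(\<Prod>i<2 * t. fact i * fact (Suc i) / 2 ^ i) * fact (2 * t) * 2 ^ (2 * t * (t - 1)) =
     (fact t)\<^sup>2 * 2 ^ t * (\<Prod>j<t. fact (2 * j + 1) ^ 4 :: real)"
proof (induction t)
  case (Suc t)
  define W :: "nat \<Rightarrow> real" where "W n = (\<Prod>i<n. fact i * fact (Suc i) / 2 ^ i)" for n
  define b :: real where "b = fact (2 * t + 1)"
  have ft: "fact (Suc t) = (real t + 1) * fact t"
    by simp
  have f2: "fact (2 * Suc t) = 2 * (real t + 1) * b"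
    by (simp add: b_def algebra_simps)
  have "W (2 * Suc t) = W (2 * t) * (fact (2 * t) * b / 2 ^ (2 * t)) * (b * fact (2 * Suc t) / 2 ^ (2 * t + 1))"
    by (simp add: W_def b_def del: fact_Suc)
  also have "\<dots> = W (2 * t) * fact (2 * t) * ((real t + 1) * b ^ 3) / 2 ^ (4 * t)"
    unfolding f2 by (simp add: field_simps power3_eq_cube flip: power_add)
  finally have W: "W (2 * Suc t) * 2 ^ (4 * t) = W (2 * t) * fact (2 * t) * ((real t + 1) * b ^ 3)"
    by simp
  \<comment> \<open>The case \<open>t = 0\<close> is separate because \<open>t - 1\<close> is
    truncated; the factor \<open>t\<close> makes the product zero there.\<close>
  have "2 * Suc t * (Suc t - 1) = 4 * t + 2 * t * (t - 1)"
    by (cases t) (simp_all add: algebra_simps)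
  then have e: "(2::real) ^ (2 * Suc t * (Suc t - 1)) = 2 ^ (4 * t) * 2 ^ (2 * t * (t - 1))"
    by (simp only: power_add)
  have "W (2 * Suc t) * fact (2 * Suc t) * 2 ^ (2 * Suc t * (Suc t - 1)) =
      (W (2 * Suc t) * 2 ^ (4 * t)) * (2 * (real t + 1) * b) * 2 ^ (2 * t * (t - 1))"
    unfolding e f2 by (simp only: mult_ac)
  also have "\<dots> = (W (2 * t) * fact (2 * t) * 2 ^ (2 * t * (t - 1))) * (2 * (real t + 1)\<^sup>2 * b ^ 4)"
    unfolding W by (simp add: power2_eq_square numeral_eq_Suc)
  also have "\<dots> = (fact (Suc t))\<^sup>2 * 2 ^ Suc t * (\<Prod>j<Suc t. fact (2 * j + 1) ^ 4)"
    unfolding Suc.IH[folded W_def]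
    by (simp add: ft b_def power_mult_distrib mult_ac del: fact_Suc)
  finally show ?case
    unfolding W_def .
qed simp

lemma prod_norms_even_eq:
  "(\<Prod>i<2 * t. fact i * fact (Suc i) / 2 ^ i) =
     (fact t)\<^sup>2 * 2 ^ t * (\<Prod>j = 1..t - 1. fact (2 * j + 1) ^ 4 :: real)
       / (fact (2 * t) * 2 ^ (2 * t * (t - 1)))"
proof -
  \<comment> \<open>The factor at \<open>j = 0\<close> is 1, and for \<open>t = 0\<close> both
    ranges are empty.\<close>
  have "(\<Prod>j<t. fact (2 * j + 1) ^ 4 :: real) = (\<Prod>j = 1..t - 1. fact (2 * j + 1) ^ 4)"
    by (intro prod.mono_neutral_right) (auto simp: Suc_le_eq)
  then show ?thesis
    using prod_norms_even[of t] by (simp add: nonzero_eq_divide_eq mult.assoc)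
qed

theorem theorem1p2:
  fixes k :: nat
  shows "hankel_euler (4 * k + 1) =
           (- 1) ^ k * ((fact (2 * k))\<^sup>2 / 2 ^ (4 * k * (2 * k - 1)))
             * (\<Prod>j = 1..2 * k - 1. fact (2 * j + 1) ^ 4) \<and>
         hankel_euler (4 * k + 2) = 0 \<and>
         hankel_euler (4 * k + 3) =
           (- 1) ^ (k + 1) * ((fact (2 * k + 1))\<^sup>2 / 2 ^ (4 * k * (2 * k + 1)))
             * (\<Prod>j = 1..2 * k. fact (2 * j + 1) ^ 4) \<and>
         hankel_euler (4 * k + 4) =
           (- 1) ^ (k + 1)
             * ((fact (2 * k + 1))\<^sup>2 * (fact (4 * k + 3))\<^sup>2 / 2 ^ (2 * (2 * k + 1)\<^sup>2))
             * (\<Prod>j = 1..2 * k. fact (2 * j + 1) ^ 4)"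
proof (intro conjI)
  let ?P = "\<lambda>n. \<Prod>j = 1..n. fact (2 * j + 1) ^ 4 :: real"
  let ?W = "\<lambda>n. \<Prod>i<n. fact i * fact (Suc i) / 2 ^ i :: real"
  have b: "(- 1 / 4) ^ k = (- 1) ^ k / (2 ^ (2 * k) :: real)"
    unfolding power_divide by (simp add: power_mult)
  have W1: "?W (4 * k) = (fact (2 * k))\<^sup>2 * 2 ^ (2 * k) * ?P (2 * k - 1)
      / (fact (4 * k) * 2 ^ (4 * k * (2 * k - 1)))"
    using prod_norms_even_eq[of "2 * k"] by (simp add: mult.assoc)
  have W2: "?W (4 * k + 2) = (fact (2 * k + 1))\<^sup>2 * 2 ^ (2 * k + 1) * ?P (2 * k)
      / (fact (4 * k + 2) * 2 ^ (4 * k * (2 * k + 1)))"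
    using prod_norms_even_eq[of "2 * k + 1"] by (simp add: algebra_simps del: fact_Suc)
  \<comment> \<open>An odd number of factors is an even product and one more factor. Its (4k + 3)!
    and the \<open>fact m\<close> of \<open>hankel_euler_Suc\<close> give the squared factorial in
    the last formula.\<close>
  have "?W (4 * k + 3) = ?W (4 * k + 2) * (fact (4 * k + 2) * fact (4 * k + 3) / 2 ^ (4 * k + 2))"
    by (simp add: numeral_3_eq_3 del: fact_Suc)
  also have "\<dots> = (fact (2 * k + 1))\<^sup>2 * 2 ^ (2 * k + 1) * ?P (2 * k) * fact (4 * k + 3)
      / (2 ^ (4 * k * (2 * k + 1)) * 2 ^ (4 * k + 2))"
    unfolding W2 by (simp add: field_simps del: fact_Suc)
  also have "(2::real) ^ (4 * k * (2 * k + 1)) * 2 ^ (4 * k + 2) = 2 ^ (2 * (2 * k + 1)\<^sup>2)"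
    by (simp add: power2_eq_square algebra_simps flip: power_add)
  finally have W3: "?W (4 * k + 3) = (fact (2 * k + 1))\<^sup>2 * 2 ^ (2 * k + 1) * ?P (2 * k)
      * fact (4 * k + 3) / 2 ^ (2 * (2 * k + 1)\<^sup>2)" .
  \<comment> \<open>The powers of two in these denominators cancel \<open>2 ^ (2 * k)\<close> in
    \<open>W1\<close> and \<open>2 ^ (2 * k + 1)\<close> in \<open>W2\<close> and
    \<open>W3\<close>.\<close>
  note p = normalized_moment_values[of k, unfolded b]
  show "hankel_euler (4 * k + 1) =
           (- 1) ^ k * ((fact (2 * k))\<^sup>2 / 2 ^ (4 * k * (2 * k - 1))) * ?P (2 * k - 1)"
    using hankel_euler_Suc[of "4 * k", unfolded W1] p by simp
  show "hankel_euler (4 * k + 2) = 0"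
    using hankel_euler_Suc[of "4 * k + 1"] p by simp
  show "hankel_euler (4 * k + 3) =
           (- 1) ^ (k + 1) * ((fact (2 * k + 1))\<^sup>2 / 2 ^ (4 * k * (2 * k + 1))) * ?P (2 * k)"
    using hankel_euler_Suc[of "4 * k + 2", unfolded W2] p
    by (simp add: numeral_3_eq_3 del: fact_Suc)
  show "hankel_euler (4 * k + 4) = (- 1) ^ (k + 1)
      * ((fact (2 * k + 1))\<^sup>2 * (fact (4 * k + 3))\<^sup>2 / 2 ^ (2 * (2 * k + 1)\<^sup>2)) * ?P (2 * k)"
  proof -
    have "hankel_euler (4 * k + 4) = hankel_euler (Suc (4 * k + 3))"
      by (rule arg_cong) simp
    then show ?thesis
      unfolding hankel_euler_Suc[of "4 * k + 3"] W3 using p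
      by (simp add: power2_eq_square del: fact_Suc)
  qed
qed

end
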